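(* Let $(H,d)$ be a Hadamard space, let $(X_n)_{n\ge 1}$ be a sequence of independent random variables with $X_n\in\mathcal{L}^2(H)$ and expectations $\mathbb{E}(X_n)=\mu_n$, and let $\mu\in H$. Put $D_n=\max_{1\le k\le n}\max\{d(\mu,\mu_k),\mathbb{E}(d(X_k,\mu_k))\}$, and let $S_n$ be the inductive mean of $X_1,\dots,X_n$. If, as $n\to\infty$, 1. $D_n\,\frac1n\sum_{k=1}^n d(\mu_k,\mu)\to 0$, and 2. $\frac1{n^2}\sum_{k=1}^n\mathrm{Var}(X_k)\to 0$, then $S_n\to\mu$ in $\mathcal{L}^2(H)$ and in probability.
   Context: A Hadamard space is a complete metric space $(H,d)$ such that for all $x,y\in H$ there is $m\in H$ with $d(z,m)^2\le\frac12 d(z,x)^2+\frac12 d(z,y)^2-\frac14 d(x,y)^2$ for all $z\in H$. Any two points $x,y\in H$ are joined by a unique minimal geodesic, i.e. a map $\gamma:[0,1]\to H$ with $\gamma(0)=x$, $\gamma(1)=y$, $d(\gamma(s),\gamma(t))=|t-s|\,d(x,y)$; write $x\oplus_t y=\gamma(t)$. The inductive mean of $x_1,x_2,\dots$ is defined by $S_1=x_1$, $S_{n+1}=S_n\oplus_{\frac1{n+1}}x_{n+1}$ (applied pointwise to random variables). A random variable in $H$ is a Borel measurable map from a probability space to $H$; $X\in\mathcal{L}^p(H)$ ($p\ge1$) means $\mathbb{E}(d(X,z)^p)<\infty$ for some (equivalently all) $z\in H$. For $X\in\mathcal{L}^2(H)$, $\mathbb{E}(X)$ is the unique minimizer of $z\mapsto\mathbb{E}(d(X,z)^2)$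 over $H$, and $\mathrm{Var}(X)=\mathbb{E}(d(X,\mathbb{E}(X))^2)$. $Z_n\to Z$ in $\mathcal{L}^2(H)$ means $\mathbb{E}(d(Z_n,Z)^2)\to0$.
   Formalization: Each X_n is assumed to lie a.s. in a closed separable set (automatic for separable H; otherwise it fails only with real-valued measurable cardinals, and a measurable cardinal refutes the claim). As S_n may be non-measurable on a null set, convergence is stated over the completed probability space. *)

theory Defs
  imports "HOL-Probability.Probability"
begin

class hadamard_space = complete_space +
  assumes hadamard_midpoint:
    "\<exists>m. \<forall>z. (dist z m)\<^sup>2 \<le> 1/2 * (dist z x)\<^sup>2 + 1/2 * (dist z y)\<^sup>2 - 1/4 * (dist x y)\<^sup>2"

definition minimal_geodesic :: "(real \<Rightarrow> 'a::metric_space) \<Rightarrow> 'a \<Rightarrow> 'a \<Rightarrow> bool" where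
  "minimal_geodesic \<gamma> x y \<longleftrightarrow> \<gamma> 0 = x \<and> \<gamma> 1 = y \<and>
     (\<forall>s\<in>{0..1}. \<forall>t\<in>{0..1}. dist (\<gamma> s) (\<gamma> t) = \<bar>t - s\<bar> * dist x y)"

text \<open>The description operator ranges over the point rather than over the curve: a curve, being
  a total function on the reals, is not determined outside the unit interval.\<close>

definition geodesic_point :: "real \<Rightarrow> 'a::hadamard_space \<Rightarrow> 'a \<Rightarrow> 'a" where
  "geodesic_point t x y = (THE z. \<exists>\<gamma>. minimal_geodesic \<gamma> x y \<and> z = \<gamma> t)"

text \<open>Sequences are indexed from 1; the value at index 0 is a dummy.\<close>

fun inductive_mean :: "(nat \<Rightarrow> 'a::hadamard_space) \<Rightarrow> nat \<Rightarrow> 'a" where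
  "inductive_mean x 0 = x 1"
| "inductive_mean x (Suc 0) = x 1"
| "inductive_mean x (Suc (Suc n)) =
     geodesic_point (1 / real (Suc (Suc n))) (inductive_mean x (Suc n)) (x (Suc (Suc n)))"

definition in_L2 :: "'w measure \<Rightarrow> ('w \<Rightarrow> 'a::metric_space) \<Rightarrow> bool" where
  "in_L2 M X \<longleftrightarrow> X \<in> borel_measurable M \<and> (\<exists>z. integrable M (\<lambda>\<omega>. (dist (X \<omega>) z)\<^sup>2))"

definition hadamard_expectation :: "'w measure \<Rightarrow> ('w \<Rightarrow> 'a::hadamard_space) \<Rightarrow> 'a" where
  "hadamard_expectation M X =
     (THE m. \<forall>z. (\<integral>\<omega>. (dist (X \<omega>) m)\<^sup>2 \<partial>M) \<le> (\<integral>\<omega>. (dist (X \<omega>) z)\<^sup>2 \<partial>M))"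

definition hadamard_variance :: "'w measure \<Rightarrow> ('w \<Rightarrow> 'a::hadamard_space) \<Rightarrow> real" where
  "hadamard_variance M X = (\<integral>\<omega>. (dist (X \<omega>) (hadamard_expectation M X))\<^sup>2 \<partial>M)"

text \<open>The law of \<open>X\<close> is concentrated on a closed separable set. This is automatic for Borel
  measurable \<open>X\<close> if the space is separable, and in general unless real-valued measurable cardinals
  exist. It cannot be dropped from the law of large numbers: if \<open>U\<close> is a countably complete
  nonprincipal ultrafilter on a set \<open>I\<close>, viewed as a 0-1-valued probability on \<open>I\<close>, and \<open>X\<close> maps
  \<open>i\<close> to the endpoint of the \<open>i\<close>-th unit edge of a star tree with edges indexed by \<open>I\<close>, then the
  constant sequence \<open>X, X, \<dots>\<close> is independent with expectation the centre and variance 1, but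
  its inductive means do not converge to the centre.\<close>

definition essentially_separable :: "'w measure \<Rightarrow> ('w \<Rightarrow> 'a::topological_space) \<Rightarrow> bool" where
  "essentially_separable M X \<longleftrightarrow> (\<exists>A. countable A \<and> (AE \<omega> in M. X \<omega> \<in> closure A))"

text \<open>Distances of two measurable functions need not be measurable when the space is not
  separable, and integrals and measures of non-measurable objects are 0 by convention. Hence the
  explicit integrability and measurability requirements.\<close>

definition tendsto_in_L2 ::
  "'w measure \<Rightarrow> (nat \<Rightarrow> 'w \<Rightarrow> 'a::metric_space) \<Rightarrow> ('w \<Rightarrow> 'a) \<Rightarrow> bool" where
  "tendsto_in_L2 M Z Y \<longleftrightarrow> (\<forall>n. in_L2 M (Z n)) \<and> in_L2 M Y \<and>
     (\<forall>n. integrable M (\<lambda>\<omega>. (dist (Z n \<omega>) (Y \<omega>))\<^sup>2)) \<and>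
     (\<lambda>n. \<integral>\<omega>. (dist (Z n \<omega>) (Y \<omega>))\<^sup>2 \<partial>M) \<longlonglongrightarrow> 0"

definition tendsto_in_probability ::
  "'w measure \<Rightarrow> (nat \<Rightarrow> 'w \<Rightarrow> 'a::metric_space) \<Rightarrow> ('w \<Rightarrow> 'a) \<Rightarrow> bool" where
  "tendsto_in_probability M Z Y \<longleftrightarrow>
     (\<forall>n. (\<lambda>\<omega>. dist (Z n \<omega>) (Y \<omega>)) \<in> borel_measurable M) \<and>
     (\<forall>\<epsilon>>0. (\<lambda>n. measure M {\<omega> \<in> space M. dist (Z n \<omega>) (Y \<omega>) > \<epsilon>}) \<longlonglongrightarrow> 0)"

text \<open>For essentially separable variables the pointwise inductive mean agrees almost surely with
  a measurable function but need not be measurable itself, because of a null set. Its convergence is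
  therefore stated over \<^term>\<open>completion M\<close>, on which integrals and probabilities of objects that
  are already measurable for \<open>M\<close> are the same.\<close>

end

theory Submission
  imports Defs
begin

text \<open>Write \<open>t = 1 / (n + 1)\<close>, \<open>\<delta>\<^sub>k = d(\<mu>\<^sub>k, \<mu>)\<close> and \<open>a\<^sub>n = E(d(S\<^sub>n, \<mu>)\<^sup>2)\<close>. Squared distances in a Hadamard
  space are uniformly convex along geodesics (lemma \<open>geodesic_point_CN\<close>), so

    \<open>d(\<mu>, S\<^sub>n\<^sub>+\<^sub>1)\<^sup>2 \<le> (1 - t) d(\<mu>, S\<^sub>n)\<^sup>2 + t d(\<mu>, X\<^sub>n\<^sub>+\<^sub>1)\<^sup>2 - t (1 - t) d(S\<^sub>n, X\<^sub>n\<^sub>+\<^sub>1)\<^sup>2\<close>.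

  Integrate. In the last term \<open>S\<^sub>n\<close> is independent of \<open>X\<^sub>n\<^sub>+\<^sub>1\<close>, so conditionally on \<open>S\<^sub>n\<close> the variance
  inequality \<open>E(d(X, z)\<^sup>2) \<ge> Var(X) + d(z, E(X))\<^sup>2\<close> applies and the term is at least
  \<open>Var(X\<^sub>n\<^sub>+\<^sub>1) + E(d(S\<^sub>n, \<mu>\<^sub>n\<^sub>+\<^sub>1)\<^sup>2)\<close>. Replace \<open>\<mu>\<^sub>n\<^sub>+\<^sub>1\<close> by \<open>\<mu>\<close> there, and conversely in the
  middle term. With \<open>D = D\<^sub>N\<close> for a fixed \<open>N > n\<close> this costs multiples of \<open>D \<delta>\<^sub>n\<^sub>+\<^sub>1\<close>, because \<open>\<delta>\<^sub>n\<^sub>+\<^sub>1\<close> and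
  \<open>E(d(X\<^sub>n\<^sub>+\<^sub>1, \<mu>\<^sub>n\<^sub>+\<^sub>1))\<close> are at most \<open>D\<close>, and \<open>E(d(S\<^sub>n, \<mu>)) \<le> 2 D\<close> by convexity of the distance. The result is

    \<open>a\<^sub>n\<^sub>+\<^sub>1 \<le> (1 - t)\<^sup>2 a\<^sub>n + t\<^sup>2 Var(X\<^sub>n\<^sub>+\<^sub>1) + 7 t D \<delta>\<^sub>n\<^sub>+\<^sub>1\<close>,

  where subtracting \<open>t (1 - t)\<close> has turned the weights \<open>1 - t\<close> and \<open>t\<close> of \<open>a\<^sub>n\<close> and of the variance into
  their squares, as for sums of independent real variables. Multiplied by \<open>(n + 1)\<^sup>2\<close> this telescopes to
  \<open>n\<^sup>2 a\<^sub>n \<le> \<Sum> Var(X\<^sub>k) + 7 n D\<^sub>n \<Sum> \<delta>\<^sub>k\<close>, where \<open>k \<le> n\<close> (lemma \<open>mean_square_inductive_mean_le\<close>), and division by \<open>n\<^sup>2\<close>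
  leaves exactly the two quantities that tend to 0 by hypothesis. Convergence in probability
  follows from Markov's inequality.

  Both the points on geodesics and the expectation are minimizers of averages of squared
  distances. One lemma about functions with the convexity of a squared distance,
  \<open>uniformly_convex_minimizer\<close>, therefore yields the geodesics and the variance inequality alike.

  The remaining work is measurability: on a nonseparable space a continuous function of two Borel
  variables need not be measurable. The variables are first changed on null sets so that all of
  them take values in one closed separable set that is stable under the geodesic steps. There every
  continuous function of two variables is a pointwise limit of functions of countably valued ones.\<close>

section \<open>Minimizers of uniformly convex functions\<close>

definition is_midpoint :: "'a::metric_space \<Rightarrow> 'a \<Rightarrow> 'a \<Rightarrow> bool" where
  "is_midpoint m x y \<longleftrightarrow>
     (\<forall>z. (dist z m)\<^sup>2 \<le> 1/2 * (dist z x)\<^sup>2 + 1/2 * (dist z y)\<^sup>2 - 1/4 * (dist x y)\<^sup>2)"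

lemma is_midpointD:
  "is_midpoint m x y \<Longrightarrow>
     (dist z m)\<^sup>2 \<le> 1/2 * (dist z x)\<^sup>2 + 1/2 * (dist z y)\<^sup>2 - 1/4 * (dist x y)\<^sup>2"
  by (simp add: is_midpoint_def)

lemma ex_midpoint: "\<exists>m. is_midpoint m x (y::'a::hadamard_space)"
  using hadamard_midpoint[of x y] by (simp add: is_midpoint_def)

lemma is_midpoint_dist:
  assumes "is_midpoint m x y"
  shows "dist x m = dist x y / 2"
proof -
  have "(dist x m)\<^sup>2 \<le> (dist x y / 2)\<^sup>2" "(dist y m)\<^sup>2 \<le> (dist x y / 2)\<^sup>2"
    using is_midpointD[OF assms, of x] is_midpointD[OF assms, of y]
    by (simp_all add: power_divide dist_commute)
  hence "dist x m \<le> dist x y / 2" "dist y m \<le> dist x y / 2"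
    by (auto intro: power2_le_imp_le)
  moreover have "dist x y \<le> dist x m + dist y m"
    by (rule dist_triangle2)
  ultimately show ?thesis by linarith
qed

text \<open>The convexity hypothesis is the midpoint inequality of a squared distance, and it passes to
  averages of such functions. A minimizing sequence is Cauchy, because the midpoint of two nearly
  minimal points cannot lie below the infimum. The quadratic growth around the minimizer \<open>p\<close>
  bootstraps: if \<open>F z \<ge> F p + c d(z, p)\<^sup>2\<close> for all \<open>z\<close>, then applying this to the midpoint of \<open>p\<close> and
  \<open>z\<close> improves the constant from \<open>c\<close> to \<open>(c + 1) / 2\<close>, and the iteration from \<open>c = 0\<close> tends to 1.\<close>

lemma uniformly_convex_minimizer:
  fixes F :: "'a::hadamard_space \<Rightarrow> real"
  assumes cont: "continuous_on UNIV F" and nonneg: "\<And>z. 0 \<le> F z"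
    and conv: "\<And>m x y. is_midpoint m x y \<Longrightarrow> F m \<le> 1/2 * F x + 1/2 * F y - 1/4 * (dist x y)\<^sup>2"
  shows "\<exists>p. \<forall>z. F p + (dist z p)\<^sup>2 \<le> F z"
proof -
  define I where "I = Inf (range F)"
  have bdd: "bdd_below (range F)"
    using nonneg by (auto intro!: bdd_belowI[of _ 0])
  have I_le: "I \<le> F z" for z
    unfolding I_def by (rule cInf_lower[OF _ bdd]) simp
  have "\<exists>z. F z < I + 1 / real (Suc n)" for n
    using cInf_lessD[of "range F" "I + 1 / real (Suc n)"] by (auto simp: I_def)
  then obtain u where u: "\<And>n. F (u n) < I + 1 / real (Suc n)" by metis
  have du: "(dist (u m) (u n))\<^sup>2 < 2 / real (Suc m) + 2 / real (Suc n)" for m n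
  proof -
    obtain q where "is_midpoint q (u m) (u n)" using ex_midpoint by blast
    from conv[OF this] I_le[of q] u[of m] u[of n] show ?thesis
      by simp
  qed
  have "Cauchy u"
  proof (rule metric_CauchyI)
    fix e :: real assume e: "0 < e"
    then obtain N :: nat where N: "4 / e\<^sup>2 < real N" using reals_Archimedean2 by blast
    show "\<exists>M. \<forall>m\<ge>M. \<forall>n\<ge>M. dist (u m) (u n) < e"
    proof (intro exI allI impI)
      fix m n assume mn: "N \<le> m" "N \<le> n"
      have N4: "4 < e\<^sup>2 * real (Suc N)"
        using N e by (simp add: field_simps add_strict_increasing)
      have "2 / real (Suc m) \<le> 2 / real (Suc N)" "2 / real (Suc n) \<le> 2 / real (Suc N)"
        using mn by (auto intro!: divide_left_mono)
      hence "(dist (u m) (u n))\<^sup>2 < 4 / real (Suc N)" using du[of m n] by linarith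
      also have "\<dots> < e\<^sup>2" using N4 by (simp add: divide_less_eq)
      finally show "dist (u m) (u n) < e" using e by (auto intro: power2_less_imp_less)
    qed
  qed
  then obtain p where p: "u \<longlonglongrightarrow> p" using Cauchy_convergent convergent_def by blast
  have "(\<lambda>n. F (u n)) \<longlonglongrightarrow> F p"
    by (rule continuous_on_tendsto_compose[OF cont p]) auto
  moreover have "(\<lambda>n. I + 1 / real (Suc n)) \<longlonglongrightarrow> I + 0"
    by (intro tendsto_intros LIMSEQ_Suc lim_1_over_n)
  ultimately have "F p \<le> I + 0"
    by (rule LIMSEQ_le) (use u less_imp_le in blast)
  hence pmin: "F p \<le> F z" for z using I_le[of z] by simp
  have growth: "F p + (1 - (1/2)^k) * (dist z p)\<^sup>2 \<le> F z" for z k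
  proof (induction k arbitrary: z)
    case 0
    then show ?case using pmin by simp
  next
    case (Suc k)
    obtain q where q: "is_midpoint q p z" using ex_midpoint by blast
    have "F p + (1 - (1/2)^k) * (dist z p / 2)\<^sup>2 \<le> F q"
      using Suc[of q] is_midpoint_dist[OF q] by (simp add: dist_commute)
    also have "\<dots> \<le> 1/2 * F p + 1/2 * F z - 1/4 * (dist z p)\<^sup>2"
      using conv[OF q] by (simp add: dist_commute)
    finally show ?case by (simp add: field_simps)
  qed
  have "F p + (dist z p)\<^sup>2 \<le> F z" for z
  proof -
    have "(\<lambda>k. F p + (1 - (1/2)^k) * (dist z p)\<^sup>2) \<longlonglongrightarrow> F p + (1 - 0) * (dist z p)\<^sup>2"
      by (intro tendsto_intros LIMSEQ_power_zero) simp
    thus ?thesis using growth by (intro LIMSEQ_le_const2) auto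
  qed
  thus ?thesis by blast
qed

section \<open>Geodesics\<close>

text \<open>The difference of the two sides, for \<open>d = a + b\<close>, is the square of \<open>(1 - t) a - t b\<close>.\<close>

lemma weighted_squares_ge:
  fixes a b d t :: real
  assumes "0 \<le> d" "d \<le> a + b"
    and "0 \<le> t" "t \<le> 1"
  shows "t * (1 - t) * d\<^sup>2 \<le> (1 - t) * a\<^sup>2 + t * b\<^sup>2"
proof -
  have "d\<^sup>2 \<le> (a + b)\<^sup>2" using assms by (intro power_mono) auto
  hence "t * (1 - t) * d\<^sup>2 \<le> t * (1 - t) * (a + b)\<^sup>2"
    using assms by (intro mult_left_mono) auto
  also have "\<dots> = (1 - t) * a\<^sup>2 + t * b\<^sup>2 - ((1 - t) * a - t * b)\<^sup>2"
    by (simp add: power2_eq_square algebra_simps)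
  also have "\<dots> \<le> (1 - t) * a\<^sup>2 + t * b\<^sup>2" by simp
  finally show ?thesis .
qed

text \<open>The point is the minimizer of \<open>(1 - t) d(z, x)\<^sup>2 + t d(z, y)\<^sup>2\<close>, whose minimal value is at least
  \<open>t (1 - t) d(x, y)\<^sup>2\<close> by the triangle inequality.\<close>

lemma ex_dividing_point:
  fixes x y :: "'a::hadamard_space"
  assumes t: "0 \<le> t" "t \<le> 1"
  shows "\<exists>p. \<forall>z. (dist z p)\<^sup>2
    \<le> (1 - t) * (dist z x)\<^sup>2 + t * (dist z y)\<^sup>2 - t * (1 - t) * (dist x y)\<^sup>2"
proof -
  define F where "F z = (1 - t) * (dist z x)\<^sup>2 + t * (dist z y)\<^sup>2" for z
  have "\<exists>p. \<forall>z. F p + (dist z p)\<^sup>2 \<le> F z"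
  proof (rule uniformly_convex_minimizer[of F])
    show "continuous_on UNIV F" unfolding F_def by (intro continuous_intros)
    show "0 \<le> F z" for z using t by (simp add: F_def)
    show "F m \<le> 1/2 * F u + 1/2 * F v - 1/4 * (dist u v)\<^sup>2" if "is_midpoint m u v" for m u v
    proof -
      have "F m \<le> (1 - t) * (1/2 * (dist x u)\<^sup>2 + 1/2 * (dist x v)\<^sup>2 - 1/4 * (dist u v)\<^sup>2)
          + t * (1/2 * (dist y u)\<^sup>2 + 1/2 * (dist y v)\<^sup>2 - 1/4 * (dist u v)\<^sup>2)"
        unfolding F_def using t is_midpointD[OF that, of x] is_midpointD[OF that, of y]
        by (intro add_mono mult_left_mono) (auto simp: dist_commute)
      also have "\<dots> = 1/2 * F u + 1/2 * F v - 1/4 * (dist u v)\<^sup>2"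
        by (simp add: F_def field_simps dist_commute)
      finally show ?thesis .
    qed
  qed
  then obtain p where p: "\<And>z. F p + (dist z p)\<^sup>2 \<le> F z" by blast
  have "t * (1 - t) * (dist x y)\<^sup>2 \<le> F p"
    unfolding F_def using t by (intro weighted_squares_ge) (auto intro: dist_triangle3)
  hence "(dist z p)\<^sup>2 \<le> F z - t * (1 - t) * (dist x y)\<^sup>2" for z
    using p[of z] by simp
  thus ?thesis unfolding F_def by blast
qed

text \<open>The minimizers \<open>\<gamma> t\<close> of the previous lemma form a minimal geodesic: inserting \<open>\<gamma> s\<close> for \<open>z\<close> into the
  inequality for \<open>\<gamma> t\<close> bounds their distance by \<open>\<bar>s - t\<bar> d(x, y)\<close>, and the triangle inequality excludes
  anything smaller. The same insertion shows that a point at the right distances from both ends is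
  \<open>\<gamma> t\<close>, so every minimal geodesic passes through it and the description operator picks it.\<close>

lemma geodesic_point_CN:
  fixes x y :: "'a::hadamard_space"
  assumes t: "0 \<le> t" "t \<le> 1"
  shows "(dist z (geodesic_point t x y))\<^sup>2
    \<le> (1 - t) * (dist z x)\<^sup>2 + t * (dist z y)\<^sup>2 - t * (1 - t) * (dist x y)\<^sup>2"
proof -
  define d where "d = dist x y"
  have "\<exists>\<gamma>. \<forall>t\<in>{0..1}. \<forall>z. (dist z (\<gamma> t))\<^sup>2
      \<le> (1 - t) * (dist z x)\<^sup>2 + t * (dist z y)\<^sup>2 - t * (1 - t) * d\<^sup>2"
    unfolding d_def using ex_dividing_point[of _ x y] by (intro bchoice) auto
  then obtain \<gamma> where \<gamma>: "\<And>t z. 0 \<le> t \<Longrightarrow> t \<le> 1 \<Longrightarrow> (dist z (\<gamma> t))\<^sup>2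
      \<le> (1 - t) * (dist z x)\<^sup>2 + t * (dist z y)\<^sup>2 - t * (1 - t) * d\<^sup>2"
    by (meson atLeastAtMost_iff)
  \<comment> \<open>A point at the right distances from both ends is \<open>\<gamma> s\<close>: the bound at that point is zero.\<close>
  have unique: "w = \<gamma> s" if s: "0 \<le> s" "s \<le> 1" "dist x w \<le> s * d" "dist y w \<le> (1 - s) * d" for w s
  proof -
    have "(dist w (\<gamma> s))\<^sup>2 \<le> (1 - s) * (dist x w)\<^sup>2 + s * (dist y w)\<^sup>2 - s * (1 - s) * d\<^sup>2"
      using \<gamma>[OF s(1,2), of w] by (simp add: dist_commute)
    also have "\<dots> \<le> (1 - s) * (s * d)\<^sup>2 + s * ((1 - s) * d)\<^sup>2 - s * (1 - s) * d\<^sup>2"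
      using s by (intro diff_right_mono add_mono mult_left_mono power_mono) auto
    also have "\<dots> = 0" by (simp add: power2_eq_square algebra_simps)
    finally show ?thesis by simp
  qed
  have dx: "dist x (\<gamma> s) \<le> s * d" and dy: "dist y (\<gamma> s) \<le> (1 - s) * d"
    if s: "0 \<le> s" "s \<le> 1" for s
  proof -
    have "(dist x (\<gamma> s))\<^sup>2 \<le> (s * d)\<^sup>2" "(dist y (\<gamma> s))\<^sup>2 \<le> ((1 - s) * d)\<^sup>2"
      using \<gamma>[OF s, of x] \<gamma>[OF s, of y]
      by (simp_all add: d_def dist_commute power2_eq_square algebra_simps)
    thus "dist x (\<gamma> s) \<le> s * d" "dist y (\<gamma> s) \<le> (1 - s) * d"
      using s by (auto intro: power2_le_imp_le simp: d_def)
  qed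
  have le: "dist (\<gamma> r) (\<gamma> s) \<le> \<bar>s - r\<bar> * d" if rs: "0 \<le> r" "r \<le> 1" "0 \<le> s" "s \<le> 1" for r s
  proof -
    have "(dist (\<gamma> r) (\<gamma> s))\<^sup>2
        \<le> (1 - s) * (dist x (\<gamma> r))\<^sup>2 + s * (dist y (\<gamma> r))\<^sup>2 - s * (1 - s) * d\<^sup>2"
      using \<gamma>[OF rs(3,4), of "\<gamma> r"] by (simp add: dist_commute)
    also have "\<dots> \<le> (1 - s) * (r * d)\<^sup>2 + s * ((1 - r) * d)\<^sup>2 - s * (1 - s) * d\<^sup>2"
      using rs dx[of r] dy[of r] by (intro diff_right_mono add_mono mult_left_mono power_mono) auto
    also have "\<dots> = (\<bar>s - r\<bar> * d)\<^sup>2" by (simp add: power2_eq_square algebra_simps)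
    finally show ?thesis by (rule power2_le_imp_le) (simp add: d_def)
  qed
  have "\<gamma> 0 = x" "\<gamma> 1 = y"
    using dx[of 0] dy[of 1] by auto
  moreover have "dist (\<gamma> r) (\<gamma> s) = \<bar>s - r\<bar> * d" if rs: "0 \<le> r" "r \<le> s" "s \<le> 1" for r s
  proof -
    have "d \<le> dist x (\<gamma> r) + dist (\<gamma> r) (\<gamma> s) + dist y (\<gamma> s)"
      using dist_triangle[of x y "\<gamma> r"] dist_triangle[of "\<gamma> r" y "\<gamma> s"]
      by (simp add: d_def dist_commute)
    moreover have "dist x (\<gamma> r) \<le> r * d" "dist y (\<gamma> s) \<le> (1 - s) * d" 
      using dx[of r] dy[of s] rs by auto
    ultimately show ?thesis using le[of r s] rs by (simp add: algebra_simps)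
  qed
  hence "dist (\<gamma> r) (\<gamma> s) = \<bar>s - r\<bar> * d" if "0 \<le> r" "r \<le> 1" "0 \<le> s" "s \<le> 1" for r s
    using that by (metis abs_minus_commute dist_commute linear)
  ultimately have geo: "minimal_geodesic \<gamma> x y"
    by (simp add: minimal_geodesic_def d_def)
  have "geodesic_point t x y = \<gamma> t"
    unfolding geodesic_point_def
  proof (rule the_equality)
    show "\<exists>\<gamma>'. minimal_geodesic \<gamma>' x y \<and> \<gamma> t = \<gamma>' t" using geo by blast
    fix w assume "\<exists>\<gamma>'. minimal_geodesic \<gamma>' x y \<and> w = \<gamma>' t"
    then obtain \<eta> where \<eta>: "minimal_geodesic \<eta> x y" "w = \<eta> t" by blast
    hence \<eta>01: "\<eta> 0 = x" "\<eta> 1 = y"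
      and "\<forall>s\<in>{0..1}. \<forall>r\<in>{0..1}. dist (\<eta> s) (\<eta> r) = \<bar>r - s\<bar> * d"
      unfolding minimal_geodesic_def d_def by blast+
    hence "dist (\<eta> 0) (\<eta> t) = \<bar>t - 0\<bar> * d" "dist (\<eta> 1) (\<eta> t) = \<bar>t - 1\<bar> * d"
      using t by (metis atLeastAtMost_iff order.refl zero_le_one)+
    hence "dist x w \<le> t * d" "dist y w \<le> (1 - t) * d"
      unfolding \<eta>01 \<eta>(2) using t by simp_all
    thus "w = \<gamma> t" by (rule unique[OF t])
  qed
  thus ?thesis using \<gamma>[OF t, of z] by (simp add: d_def)
qed

text \<open>Inserting \<open>d(x, y) \<ge> \<bar>d(z, x) - d(z, y)\<bar>\<close> into the previous inequality turns its right-hand side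
  into a perfect square.\<close>

lemma geodesic_point_dist_le:
  fixes x y :: "'a::hadamard_space"
  assumes t: "0 \<le> t" "t \<le> 1"
  shows "dist z (geodesic_point t x y) \<le> (1 - t) * dist z x + t * dist z y"
proof (rule power2_le_imp_le)
  have "\<bar>dist z x - dist z y\<bar> \<le> dist x y"
    by (metis abs_dist_diff_le dist_commute)
  hence "\<bar>dist z x - dist z y\<bar>\<^sup>2 \<le> (dist x y)\<^sup>2" by (intro power_mono) auto
  hence "t * (1 - t) * (dist z x - dist z y)\<^sup>2 \<le> t * (1 - t) * (dist x y)\<^sup>2"
    using t by (intro mult_left_mono) auto
  with geodesic_point_CN[OF t, of z x y]
  have "(dist z (geodesic_point t x y))\<^sup>2 \<le> (1 - t) * (dist z x)\<^sup>2 + t * (dist z y)\<^sup>2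
      - t * (1 - t) * (dist z x - dist z y)\<^sup>2" by linarith
  also have "\<dots> = ((1 - t) * dist z x + t * dist z y)\<^sup>2"
    by (simp add: power2_eq_square algebra_simps)
  finally show "(dist z (geodesic_point t x y))\<^sup>2 \<le> ((1 - t) * dist z x + t * dist z y)\<^sup>2" .
qed (use t in auto)

text \<open>The distance from \<open>p i\<close>, the point between \<open>f i\<close> and \<open>g i\<close>, to the limit is estimated by the
  inequality \<open>geodesic_point_CN\<close> at \<open>z = p i\<close>. As \<open>p i\<close> is close to having the distances \<open>t d(x, y)\<close> and
  \<open>(1 - t) d(x, y)\<close> from \<open>x\<close> and \<open>y\<close>, for which the bound vanishes, the bound tends to 0.\<close>

lemma tendsto_geodesic_point:
  fixes f g :: "'b \<Rightarrow> 'a::hadamard_space"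
  assumes t: "0 \<le> t" "t \<le> 1" and f: "(f \<longlongrightarrow> x) G" and g: "(g \<longlongrightarrow> y) G"
  shows "((\<lambda>i. geodesic_point t (f i) (g i)) \<longlongrightarrow> geodesic_point t x y) G"
proof -
  define p where "p i = geodesic_point t (f i) (g i)" for i
  define q where "q = geodesic_point t x y"
  define B where "B i = (1 - t) * (dist x (f i) + t * dist (f i) (g i))\<^sup>2
    + t * (dist y (g i) + (1 - t) * dist (f i) (g i))\<^sup>2 - t * (1 - t) * (dist x y)\<^sup>2" for i
  have "(dist (p i) q)\<^sup>2 \<le> B i" for i
  proof -
    have "dist x (p i) \<le> dist x (f i) + dist (f i) (p i)" "dist y (p i) \<le> dist y (g i) + dist (g i) (p i)"
      by (rule dist_triangle)+
    moreover have "dist (f i) (p i) \<le> t * dist (f i) (g i)" "dist (g i) (p i) \<le> (1 - t) * dist (f i) (g i)"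
      using geodesic_point_dist_le[OF t, of "f i" "f i" "g i"] 
        geodesic_point_dist_le[OF t, of "g i" "f i" "g i"] by (auto simp: p_def dist_commute)
    ultimately have *: "dist x (p i) \<le> dist x (f i) + t * dist (f i) (g i)"
      "dist y (p i) \<le> dist y (g i) + (1 - t) * dist (f i) (g i)" by linarith+
    have "(dist (p i) q)\<^sup>2
        \<le> (1 - t) * (dist x (p i))\<^sup>2 + t * (dist y (p i))\<^sup>2 - t * (1 - t) * (dist x y)\<^sup>2"
      using geodesic_point_CN[OF t, of "p i" x y] by (simp add: q_def dist_commute)
    also have "\<dots> \<le> B i" unfolding B_def
      using t * by (intro diff_right_mono add_mono mult_left_mono power_mono) auto
    finally show ?thesis .
  qed
  hence le: "eventually (\<lambda>i. (dist (p i) q)\<^sup>2 \<le> B i) G" by simp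
  have "(B \<longlongrightarrow> (1 - t) * (dist x x + t * dist x y)\<^sup>2
    + t * (dist y y + (1 - t) * dist x y)\<^sup>2 - t * (1 - t) * (dist x y)\<^sup>2) G"
    unfolding B_def by (intro tendsto_intros f g)
  hence "(B \<longlongrightarrow> 0) G"
    by (simp add: power2_eq_square algebra_simps)
  with le have "((\<lambda>i. (dist (p i) q)\<^sup>2) \<longlongrightarrow> 0) G"
    using tendsto_sandwich[OF _ le tendsto_const, of 0] by simp
  hence "((\<lambda>i. sqrt ((dist (p i) q)\<^sup>2)) \<longlongrightarrow> sqrt 0) G" by (rule tendsto_real_sqrt)
  thus ?thesis by (subst tendsto_dist_iff) (simp flip: p_def q_def)
qed

section \<open>Measurability of inductive means\<close>

lemma borel_measurable_dist_const [measurable (raw)]: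
  fixes f :: "'w \<Rightarrow> 'a::metric_space"
  assumes "f \<in> borel_measurable N"
  shows "(\<lambda>w. dist (f w) c) \<in> borel_measurable N"
  using assms by (rule borel_measurable_continuous_on[rotated]) (intro continuous_intros)

text \<open>The product of two Borel \<open>\<sigma>\<close>-algebras can be smaller than the Borel \<open>\<sigma>\<close>-algebra of the product,
  so the continuity of \<open>G\<close> is not enough by itself. If both arguments lie in the closure of a
  sequence, each is a limit of variables with values in that sequence, and a function of two
  countably valued variables is measurable.\<close>

lemma borel_measurable_sequentially_continuous_pair:
  fixes G :: "'a::metric_space \<Rightarrow> 'a \<Rightarrow> 'b::metric_space" and a :: "nat \<Rightarrow> 'a"
  assumes cont: "\<And>u v x y. u \<longlonglongrightarrow> x \<Longrightarrow> v \<longlonglongrightarrow> y \<Longrightarrow> (\<lambda>n. G (u n) (v n)) \<longlonglongrightarrow> G x y"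
    and g [measurable]: "g \<in> borel_measurable N" and h [measurable]: "h \<in> borel_measurable N"
    and sep: "\<And>w. w \<in> space N \<Longrightarrow> g w \<in> closure (range a)" "\<And>w. w \<in> space N \<Longrightarrow> h w \<in> closure (range a)"
  shows "(\<lambda>w. G (g w) (h w)) \<in> borel_measurable N"
proof -
  define idx where "idx j x = (LEAST i. dist x (a i) < 1 / real (Suc j))" for j x
  have idx_dist: "dist x (a (idx j x)) < 1 / real (Suc j)" if x: "x \<in> closure (range a)" for x j
  proof -
    obtain i where "dist x (a i) < 1 / real (Suc j)"
      using x unfolding closure_approachable by (metis dist_commute of_nat_0_less_iff rangeE zero_less_Suc zero_less_divide_1_iff)
    thus ?thesis unfolding idx_def by (rule LeastI)
  qed
  have idx_lim: "(\<lambda>j. a (idx j x)) \<longlonglongrightarrow> x" if x: "x \<in> closure (range a)" for x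
  proof (rule metric_tendsto_imp_tendsto[OF LIMSEQ_Suc[OF lim_1_over_n]])
    show "\<forall>\<^sub>F j in sequentially. dist (a (idx j x)) x \<le> dist (1 / real (Suc j)) 0"
      using idx_dist[OF x] by (auto simp: dist_commute less_imp_le)
  qed
  have [measurable]: "(\<lambda>w. idx j (g w)) \<in> measurable N (count_space UNIV)"
    "(\<lambda>w. idx j (h w)) \<in> measurable N (count_space UNIV)" for j
    unfolding idx_def by measurable
  have "(\<lambda>w. G (a (idx j (g w))) (a (idx j (h w)))) \<in> borel_measurable N" for j
    by (rule measurable_compose_countable[where g="\<lambda>w. idx j (g w)"],
        rule measurable_compose_countable[where g="\<lambda>w. idx j (h w)"]) simp_all
  moreover have "(\<lambda>j. G (a (idx j (g w))) (a (idx j (h w)))) \<longlonglongrightarrow> G (g w) (h w)" if "w \<in> space N" for w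
    using sep[OF that] by (intro cont idx_lim)
  ultimately show ?thesis by (rule borel_measurable_LIMSEQ_metric)
qed

text \<open>Stability under all the steps that occur in an inductive mean, rather than under all geodesics:
  these are countably many operations, so a countable set has a countable stable hull.\<close>

definition mean_closed :: "'a::hadamard_space set \<Rightarrow> bool" where
  "mean_closed C \<longleftrightarrow> (\<forall>n. \<forall>x\<in>C. \<forall>y\<in>C. geodesic_point (1 / real n) x y \<in> C)"

lemma unit_fraction_bounds: "0 \<le> 1 / real n" "1 / real n \<le> 1"
  by (cases n; simp)+

lemma countable_mean_closed_hull:
  fixes A :: "'a::hadamard_space set"
  assumes "countable A"
  obtains B where "countable B" "A \<subseteq> B" "mean_closed B"
proof -
  define step where "step S = S \<union> (\<Union>n. \<Union>x\<in>S. geodesic_point (1 / real n) x ` S)" for S :: "'a set"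
  define B where "B = (\<Union>k. (step ^^ k) A)"
  have "countable ((step ^^ k) A)" for k
    by (induction k) (auto simp: step_def assms)
  hence "countable B" by (simp add: B_def)
  moreover have "A \<subseteq> B" unfolding B_def by (auto intro!: UN_I[of 0])
  moreover have "mean_closed B"
    unfolding mean_closed_def
  proof (intro allI ballI)
    fix n x y assume "x \<in> B" "y \<in> B"
    then obtain i j where ij: "x \<in> (step ^^ i) A" "y \<in> (step ^^ j) A" by (auto simp: B_def)
    have mono: "(step ^^ i) A \<subseteq> (step ^^ (i + d)) A" for i d
      by (induction d) (auto simp: step_def)
    have "x \<in> (step ^^ (i + j)) A" "y \<in> (step ^^ (i + j)) A"
      using ij mono[of i j] mono[of j i] by (auto simp: add.commute)
    hence "geodesic_point (1 / real n) x y \<in> step ((step ^^ (i + j)) A)"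
      unfolding step_def by blast
    also have "\<dots> = (step ^^ Suc (i + j)) A" by simp
    also have "\<dots> \<subseteq> B" unfolding B_def by blast
    finally show "geodesic_point (1 / real n) x y \<in> B" .
  qed
  ultimately show ?thesis by (rule that)
qed

lemma mean_closed_closure:
  assumes "mean_closed B"
  shows "mean_closed (closure B)"
  unfolding mean_closed_def
proof (intro allI ballI)
  fix n x y assume "x \<in> closure B" "y \<in> closure B"
  then obtain u v where "\<And>i. u i \<in> B" "u \<longlonglongrightarrow> x" "\<And>i. v i \<in> B" "v \<longlonglongrightarrow> y"
    by (metis closure_sequential)
  thus "geodesic_point (1 / real n) x y \<in> closure B"
    using assms unfolding closure_sequential mean_closed_def
    by (intro exI[of _ "\<lambda>i. geodesic_point (1 / real n) (u i) (v i)"])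
      (auto intro!: tendsto_geodesic_point unit_fraction_bounds)
qed

lemma inductive_mean_step:
  "n \<ge> 1 \<Longrightarrow> inductive_mean x (Suc n) = geodesic_point (1 / real (Suc n)) (inductive_mean x n) (x (Suc n))"
  by (cases n) auto

lemma inductive_mean_cong:
  assumes "n \<ge> 1" "\<And>k. 1 \<le> k \<Longrightarrow> k \<le> n \<Longrightarrow> x k = y k"
  shows "inductive_mean x n = inductive_mean y n"
  using assms by (induction n rule: nat_induct_at_least) (simp_all add: inductive_mean_step)

lemma inductive_mean_mem:
  assumes "mean_closed C" "n \<ge> 1" "\<And>k. 1 \<le> k \<Longrightarrow> k \<le> n \<Longrightarrow> x k \<in> C"
  shows "inductive_mean x n \<in> C"
  using assms(2,3)
proof (induction n rule: nat_induct_at_least)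
  case (Suc n)
  hence "inductive_mean x n \<in> C" "x (Suc n) \<in> C" by auto
  thus ?case using assms(1) unfolding inductive_mean_step[OF Suc.hyps] mean_closed_def by blast
qed simp

lemma borel_measurable_inductive_mean:
  fixes a :: "nat \<Rightarrow> 'a::hadamard_space"
  assumes closed: "mean_closed (closure (range a))" and n: "n \<ge> 1"
    and Y: "\<And>k. 1 \<le> k \<Longrightarrow> k \<le> n \<Longrightarrow> Y k \<in> borel_measurable N"
    and sep: "\<And>k w. 1 \<le> k \<Longrightarrow> k \<le> n \<Longrightarrow> w \<in> space N \<Longrightarrow> Y k w \<in> closure (range a)"
  shows "(\<lambda>w. inductive_mean (\<lambda>k. Y k w) n) \<in> borel_measurable N"
  using n Y sep
proof (induction n rule: nat_induct_at_least)
  case base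
  then show ?case by simp
next
  case (Suc n)
  have mean: "(\<lambda>w. inductive_mean (\<lambda>k. Y k w) n) \<in> borel_measurable N"
    using Suc.prems by (intro Suc.IH) auto
  show ?case unfolding inductive_mean_step[OF Suc.hyps]
  proof (rule borel_measurable_sequentially_continuous_pair[where a=a and G="geodesic_point (1 / real (Suc n))", OF _ mean])
    show "inductive_mean (\<lambda>k. Y k w) n \<in> closure (range a)" if "w \<in> space N" for w
      using Suc that by (intro inductive_mean_mem closed) auto
  qed (use Suc.prems in \<open>auto intro!: tendsto_geodesic_point unit_fraction_bounds simp del: of_nat_Suc\<close>)
qed

section \<open>Independence and the variance inequality\<close>

text \<open>The mean of the first \<open>n\<close> variables is a measurable function of the tuple of these variables, for
  the product \<open>\<sigma>\<close>-algebra, and this tuple is independent of the next variable.\<close>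

lemma (in prob_space) indep_var_inductive_mean_next:
  fixes a :: "nat \<Rightarrow> 'b::hadamard_space"
  assumes closed: "mean_closed (closure (range a))" and n: "n \<ge> 1"
    and indep: "indep_vars (\<lambda>_. borel) Y {1..}"
    and sep: "\<And>k \<omega>. 1 \<le> k \<Longrightarrow> Y k \<omega> \<in> closure (range a)"
  shows "indep_var borel (\<lambda>\<omega>. inductive_mean (\<lambda>k. Y k \<omega>) n) borel (Y (Suc n))"
proof -
  \<comment> \<open>Off the closed set the map must still be defined and measurable on the whole product.\<close>
  define r where "r x = (if x \<in> closure (range a) then x else a 0)" for x
  have r [measurable]: "r \<in> borel_measurable borel" unfolding r_def by measurable
  define \<Phi> where "\<Phi> f = inductive_mean (\<lambda>k. r (f k)) n" for f
  have "\<Phi> \<in> borel_measurable (PiM {1..n} (\<lambda>_. borel))"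
    unfolding \<Phi>_def
  proof (rule borel_measurable_inductive_mean[OF closed n])
    show "(\<lambda>f. r (f k)) \<in> borel_measurable (PiM {1..n} (\<lambda>_. borel))" if "1 \<le> k" "k \<le> n" for k
      by (rule measurable_compose[OF _ r], rule measurable_component_singleton) (use that in simp)
    show "r x \<in> closure (range a)" for x
      using closure_subset[of "range a"] by (auto simp: r_def)
  qed
  hence "indep_var borel (\<Phi> \<circ> (\<lambda>\<omega>. restrict (\<lambda>i. Y i \<omega>) {1..n}))
      borel ((\<lambda>f. f (Suc n)) \<circ> (\<lambda>\<omega>. restrict (\<lambda>i. Y i \<omega>) {Suc n}))"
    by (intro indep_var_compose[OF indep_var_restrict[OF indep]]) auto
  also have "\<Phi> \<circ> (\<lambda>\<omega>. restrict (\<lambda>i. Y i \<omega>) {1..n}) = (\<lambda>\<omega>. inductive_mean (\<lambda>k. Y k \<omega>) n)"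
    using sep n by (auto simp: \<Phi>_def r_def fun_eq_iff intro!: inductive_mean_cong)
  also have "(\<lambda>f. f (Suc n)) \<circ> (\<lambda>\<omega>. restrict (\<lambda>i. Y i \<omega>) {Suc n}) = Y (Suc n)" by auto
  finally show ?thesis .
qed

lemma dist_squared_le_double: "(dist x y)\<^sup>2 \<le> 2 * (dist x z)\<^sup>2 + 2 * (dist y z)\<^sup>2"
proof -
  have "(dist x y)\<^sup>2 \<le> (dist x z + dist y z)\<^sup>2"
    by (intro power_mono dist_triangle2) simp
  also have "\<dots> \<le> 2 * (dist x z)\<^sup>2 + 2 * (dist y z)\<^sup>2"
    using sum_squares_bound[of "dist x z" "dist y z"] by (simp add: power2_sum)
  finally show ?thesis .
qed

lemma (in finite_measure) in_L2_integrable: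
  assumes "in_L2 M X"
  shows "integrable M (\<lambda>\<omega>. (dist (X \<omega>) z)\<^sup>2)" "integrable M (\<lambda>\<omega>. dist (X \<omega>) z)"
proof -
  obtain y where [measurable]: "X \<in> borel_measurable M"
    and y: "integrable M (\<lambda>\<omega>. (dist (X \<omega>) y)\<^sup>2)"
    using assms by (auto simp: in_L2_def)
  have "integrable M (\<lambda>\<omega>. 2 * (dist (X \<omega>) y)\<^sup>2 + 2 * (dist z y)\<^sup>2)" using y by simp
  thus sq: "integrable M (\<lambda>\<omega>. (dist (X \<omega>) z)\<^sup>2)"
    by (rule Bochner_Integration.integrable_bound) (use dist_squared_le_double in auto)
  hence "integrable M (\<lambda>\<omega>. 1 + (dist (X \<omega>) z)\<^sup>2)" by simp
  moreover have "c \<le> 1 + c\<^sup>2" for c :: real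
    using sum_squares_bound[of 1 c] zero_le_power2[of c] by (cases "0 \<le> c") (simp, linarith)
  ultimately show "integrable M (\<lambda>\<omega>. dist (X \<omega>) z)"
    by (auto intro: Bochner_Integration.integrable_bound)
qed

text \<open>Averaging over \<open>X\<close> preserves the midpoint inequality, so \<open>z \<mapsto> E(d(X, z)\<^sup>2)\<close> has a minimizer with
  quadratic growth around it. By the growth it is the only minimizer, that is, the expectation.\<close>

lemma (in prob_space) hadamard_variance_inequality:
  fixes X :: "'a \<Rightarrow> 'b::hadamard_space"
  assumes X: "in_L2 M X"
  defines "m \<equiv> hadamard_expectation M X"
  shows "(\<integral>\<omega>. (dist (X \<omega>) m)\<^sup>2 \<partial>M) + (dist z m)\<^sup>2 \<le> (\<integral>\<omega>. (dist (X \<omega>) z)\<^sup>2 \<partial>M)"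
proof -
  note int [simp] = in_L2_integrable[OF X]
  define F where "F z = (\<integral>\<omega>. (dist (X \<omega>) z)\<^sup>2 \<partial>M)" for z
  have "\<exists>p. \<forall>z. F p + (dist z p)\<^sup>2 \<le> F z"
  proof (rule uniformly_convex_minimizer[of F])
    show "0 \<le> F z" for z by (simp add: F_def)
    show "F q \<le> 1/2 * F x + 1/2 * F y - 1/4 * (dist x y)\<^sup>2" if "is_midpoint q x y" for q x y
    proof -
      have "F q \<le> (\<integral>\<omega>. 1/2 * (dist (X \<omega>) x)\<^sup>2 + 1/2 * (dist (X \<omega>) y)\<^sup>2 - 1/4 * (dist x y)\<^sup>2 \<partial>M)"
        unfolding F_def using is_midpointD[OF that] by (intro integral_mono) auto
      also have "\<dots> = 1/2 * F x + 1/2 * F y - 1/4 * (dist x y)\<^sup>2"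
        by (simp add: F_def prob_space)
      finally show ?thesis .
    qed
    show "continuous_on UNIV F"
      unfolding continuous_on_def
    proof (intro ballI)
      fix y
      define E where "E = (\<integral>\<omega>. dist (X \<omega>) y \<partial>M)"
      have bound: "\<bar>F z - F y\<bar> \<le> dist z y * (2 * E + dist z y)" for z
      proof -
        have "\<bar>(dist (X \<omega>) z)\<^sup>2 - (dist (X \<omega>) y)\<^sup>2\<bar> \<le> dist z y * (2 * dist (X \<omega>) y + dist z y)" for \<omega>
        proof -
          have le: "\<bar>dist (X \<omega>) z - dist (X \<omega>) y\<bar> \<le> dist z y"
            by (metis abs_dist_diff_le dist_commute)
          have "(dist (X \<omega>) z)\<^sup>2 - (dist (X \<omega>) y)\<^sup>2
              = (dist (X \<omega>) z - dist (X \<omega>) y) * (dist (X \<omega>) z + dist (X \<omega>) y)"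
            by (simp add: power2_eq_square algebra_simps)
          hence "\<bar>(dist (X \<omega>) z)\<^sup>2 - (dist (X \<omega>) y)\<^sup>2\<bar>
              = \<bar>dist (X \<omega>) z - dist (X \<omega>) y\<bar> * (dist (X \<omega>) z + dist (X \<omega>) y)"
            by (simp add: abs_mult)
          also have "\<dots> \<le> dist z y * (2 * dist (X \<omega>) y + dist z y)"
            using le by (intro mult_mono) auto
          finally show ?thesis .
        qed
        hence "\<bar>\<integral>\<omega>. (dist (X \<omega>) z)\<^sup>2 - (dist (X \<omega>) y)\<^sup>2 \<partial>M\<bar>
            \<le> (\<integral>\<omega>. dist z y * (2 * dist (X \<omega>) y + dist z y) \<partial>M)"
          by (intro order_trans[OF integral_abs_bound] integral_mono) auto
        thus ?thesis by (simp add: F_def E_def prob_space)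
      qed
      have "((\<lambda>z. dist z y * (2 * E + dist z y)) \<longlongrightarrow> dist y y * (2 * E + dist y y)) (at y)"
        by (intro tendsto_intros)
      hence lim: "((\<lambda>z. dist z y * (2 * E + dist z y)) \<longlongrightarrow> 0) (at y)" by simp
      have "((\<lambda>z. F z - F y) \<longlongrightarrow> 0) (at y)"
        by (rule Lim_null_comparison[OF _ lim]) (simp add: bound)
      thus "(F \<longlongrightarrow> F y) (at y within UNIV)" by (rule LIM_zero_cancel)
    qed
  qed
  then obtain p where p: "\<And>z. F p + (dist z p)\<^sup>2 \<le> F z" by blast
  have "m = p"
    unfolding m_def hadamard_expectation_def F_def[symmetric]
  proof (rule the_equality)
    show "\<forall>z. F p \<le> F z" using p by (meson le_add_same_cancel1 order_trans zero_le_power2)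
    fix q assume "\<forall>z. F q \<le> F z"
    hence "F q \<le> F p" by blast
    hence "(dist q p)\<^sup>2 \<le> 0" using p[of q] by linarith
    thus "q = p" by simp
  qed
  thus ?thesis using p[of z] by (simp add: F_def)
qed

text \<open>By Fubini's theorem, \<open>E(d(S, Y)\<^sup>2)\<close> is the average over the law of \<open>S\<close> of \<open>E(d(Y, z)\<^sup>2)\<close> at
  \<open>z = S\<close>. The squared distance must be jointly measurable for this, which is what the separability
  is for.\<close>

lemma (in prob_space) mean_square_dist_indep_ge:
  fixes S Y :: "'a \<Rightarrow> 'b::metric_space" and a :: "nat \<Rightarrow> 'b"
  assumes indep: "indep_var borel S borel Y"
    and sep: "\<And>\<omega>. S \<omega> \<in> closure (range a)" "\<And>\<omega>. Y \<omega> \<in> closure (range a)"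
    and L2: "in_L2 M S" "in_L2 M Y"
    and var: "\<And>z. V + (dist z m)\<^sup>2 \<le> (\<integral>\<omega>. (dist (Y \<omega>) z)\<^sup>2 \<partial>M)"
  shows "integrable M (\<lambda>\<omega>. (dist (S \<omega>) (Y \<omega>))\<^sup>2)"
    and "V + (\<integral>\<omega>. (dist (S \<omega>) m)\<^sup>2 \<partial>M) \<le> (\<integral>\<omega>. (dist (S \<omega>) (Y \<omega>))\<^sup>2 \<partial>M)"
proof -
  have [measurable]: "S \<in> borel_measurable M" "Y \<in> borel_measurable M"
    using L2 by (auto simp: in_L2_def)
  \<comment> \<open>A retraction onto the closed set makes the squared distance measurable on the whole product.\<close>
  define r where "r x = (if x \<in> closure (range a) then x else a 0)" for x
  have [measurable]: "r \<in> borel_measurable borel" unfolding r_def by measurable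
  have r_mem: "r x \<in> closure (range a)" for x
    using closure_subset[of "range a"] by (auto simp: r_def)
  have rS [simp]: "r (S \<omega>) = S \<omega>" and rY [simp]: "r (Y \<omega>) = Y \<omega>" for \<omega>
    using sep by (auto simp: r_def)
  define \<delta> where "\<delta> p = (dist (r (fst p)) (r (snd p)))\<^sup>2" for p
  have \<delta> [measurable]: "\<delta> \<in> borel_measurable (borel \<Otimes>\<^sub>M borel)"
    unfolding \<delta>_def
    by (rule borel_measurable_sequentially_continuous_pair[where a=a and G="\<lambda>x y. (dist x y)\<^sup>2"])
      (auto intro!: tendsto_intros r_mem)
  have "integrable M (\<lambda>\<omega>. 2 * (dist (S \<omega>) m)\<^sup>2 + 2 * (dist (Y \<omega>) m)\<^sup>2)"
    using in_L2_integrable(1)[OF L2(1), of m] in_L2_integrable(1)[OF L2(2), of m] by simp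
  moreover have "(\<lambda>\<omega>. \<delta> (S \<omega>, Y \<omega>)) \<in> borel_measurable M" by measurable
  hence "(\<lambda>\<omega>. (dist (S \<omega>) (Y \<omega>))\<^sup>2) \<in> borel_measurable M" by (simp add: \<delta>_def)
  ultimately show int: "integrable M (\<lambda>\<omega>. (dist (S \<omega>) (Y \<omega>))\<^sup>2)"
    by (rule Bochner_Integration.integrable_bound) (use dist_squared_le_double in auto)
  let ?P = "distr M borel S" and ?Q = "distr M borel Y"
  interpret P: prob_space ?P by (rule prob_space_distr) simp
  interpret Q: prob_space ?Q by (rule prob_space_distr) simp
  interpret PQ: pair_prob_space ?P ?Q ..
  have joint: "?P \<Otimes>\<^sub>M ?Q = distr M (borel \<Otimes>\<^sub>M borel) (\<lambda>\<omega>. (S \<omega>, Y \<omega>))"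
    using indep by (simp add: indep_var_distribution_eq)
  have int\<delta>: "integrable (?P \<Otimes>\<^sub>M ?Q) \<delta>"
    unfolding joint using int by (subst integrable_distr_eq) (simp_all add: \<delta>_def)
  have "V + (\<integral>\<omega>. (dist (S \<omega>) m)\<^sup>2 \<partial>M) = (\<integral>\<omega>. V + (dist (S \<omega>) m)\<^sup>2 \<partial>M)"
    using in_L2_integrable(1)[OF L2(1)] by (simp add: prob_space)
  also have "\<dots> \<le> (\<integral>\<omega>. (\<integral>y. \<delta> (S \<omega>, y) \<partial>?Q) \<partial>M)"
  proof (rule integral_mono)
    show "integrable M (\<lambda>\<omega>. V + (dist (S \<omega>) m)\<^sup>2)"
      using in_L2_integrable(1)[OF L2(1)] by simp
    have "integrable ?P (\<lambda>x. \<integral>y. \<delta> (x, y) \<partial>?Q)" by (rule PQ.integrable_fst'[OF int\<delta>])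
    thus "integrable M (\<lambda>\<omega>. \<integral>y. \<delta> (S \<omega>, y) \<partial>?Q)"
      by (rule integrable_distr[rotated]) simp
    show "V + (dist (S \<omega>) m)\<^sup>2 \<le> (\<integral>y. \<delta> (S \<omega>, y) \<partial>?Q)" for \<omega>
    proof -
      have "(\<integral>y. \<delta> (S \<omega>, y) \<partial>?Q) = (\<integral>\<omega>'. (dist (Y \<omega>') (S \<omega>))\<^sup>2 \<partial>M)"
      proof (subst integral_distr)
        have "(\<lambda>y. \<delta> (S \<omega>, y)) \<in> borel_measurable borel" by measurable
        thus "(\<lambda>y. \<delta> (S \<omega>, y)) \<in> borel_measurable borel" .
      qed (simp_all add: \<delta>_def dist_commute)
      thus ?thesis using var[of "S \<omega>"] by simp
    qed
  qed
  also have "\<dots> = (\<integral>x. (\<integral>y. \<delta> (x, y) \<partial>?Q) \<partial>?P)"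
    by (rule integral_distr[symmetric]) (use PQ.integrable_fst'[OF int\<delta>] in auto)
  also have "\<dots> = (\<integral>p. \<delta> p \<partial>(?P \<Otimes>\<^sub>M ?Q))" by (rule PQ.integral_fst'[OF int\<delta>])
  also have "\<dots> = (\<integral>\<omega>. (dist (S \<omega>) (Y \<omega>))\<^sup>2 \<partial>M)"
    unfolding joint by (subst integral_distr) (simp_all add: \<delta>_def)
  finally show "V + (\<integral>\<omega>. (dist (S \<omega>) m)\<^sup>2 \<partial>M) \<le> (\<integral>\<omega>. (dist (S \<omega>) (Y \<omega>))\<^sup>2 \<partial>M)" .
qed

section \<open>The mean square error\<close>

lemma (in finite_measure) in_L2_inductive_mean:
  fixes a :: "nat \<Rightarrow> 'b::hadamard_space"
  assumes closed: "mean_closed (closure (range a))" and n: "n \<ge> 1"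
    and sep: "\<And>k \<omega>. 1 \<le> k \<Longrightarrow> Y k \<omega> \<in> closure (range a)"
    and L2: "\<And>k. 1 \<le> k \<Longrightarrow> in_L2 M (Y k)"
  shows "in_L2 M (\<lambda>\<omega>. inductive_mean (\<lambda>k. Y k \<omega>) n)"
  using n
proof (induction n rule: nat_induct_at_least)
  case base
  then show ?case using L2[of 1] by simp
next
  case (Suc n)
  define t where "t = 1 / real (Suc n)"
  have t: "0 \<le> t" "t \<le> 1" by (simp_all add: t_def)
  define S where "S j \<omega> = inductive_mean (\<lambda>k. Y k \<omega>) j" for j \<omega>
  have meas [measurable]: "S (Suc n) \<in> borel_measurable M"
    unfolding S_def using L2 sep
    by (intro borel_measurable_inductive_mean[OF closed]) (auto simp: in_L2_def)
  define z where "z = a 0"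
  have "(dist (S (Suc n) \<omega>) z)\<^sup>2 \<le> (dist (S n \<omega>) z)\<^sup>2 + (dist (Y (Suc n) \<omega>) z)\<^sup>2" for \<omega>
  proof -
    have "(dist z (S (Suc n) \<omega>))\<^sup>2 \<le> (1 - t) * (dist z (S n \<omega>))\<^sup>2 + t * (dist z (Y (Suc n) \<omega>))\<^sup>2
        - t * (1 - t) * (dist (S n \<omega>) (Y (Suc n) \<omega>))\<^sup>2"
      unfolding S_def inductive_mean_step[OF Suc.hyps] t_def
      by (intro geodesic_point_CN unit_fraction_bounds)
    also have "\<dots> \<le> (1 - t) * (dist z (S n \<omega>))\<^sup>2 + t * (dist z (Y (Suc n) \<omega>))\<^sup>2"
      using t by simp
    also have "\<dots> \<le> 1 * (dist z (S n \<omega>))\<^sup>2 + 1 * (dist z (Y (Suc n) \<omega>))\<^sup>2"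
      using t by (intro add_mono mult_right_mono) auto
    finally show ?thesis by (simp add: dist_commute)
  qed
  moreover have "integrable M (\<lambda>\<omega>. (dist (S n \<omega>) z)\<^sup>2 + (dist (Y (Suc n) \<omega>) z)\<^sup>2)"
    using in_L2_integrable(1)[OF Suc.IH, of z] in_L2_integrable(1)[OF L2[of "Suc n"], of z]
    by (simp add: S_def)
  ultimately have "integrable M (\<lambda>\<omega>. (dist (S (Suc n) \<omega>) z)\<^sup>2)"
    by (auto intro: Bochner_Integration.integrable_bound)
  thus ?case using meas unfolding in_L2_def S_def by blast
qed

text \<open>Induction on the number of variables, with the bound \<open>D\<close> for all \<open>n\<close> of them. The constant 7 is 3,
  from comparing \<open>E(d(Y k, \<mu>)\<^sup>2)\<close> with \<open>V k\<close>, plus 4, from comparing \<open>E(d(S, m k)\<^sup>2)\<close> with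
  \<open>E(d(S, \<mu>)\<^sup>2)\<close> for the mean \<open>S\<close> of the variables before \<open>Y k\<close>.\<close>

lemma (in prob_space) mean_square_inductive_mean_le:
  fixes a :: "nat \<Rightarrow> 'b::hadamard_space"
  assumes closed: "mean_closed (closure (range a))" and n: "n \<ge> 1"
    and indep: "indep_vars (\<lambda>_. borel) Y {1..}"
    and sep: "\<And>k \<omega>. 1 \<le> k \<Longrightarrow> Y k \<omega> \<in> closure (range a)"
    and L2: "\<And>k. 1 \<le> k \<Longrightarrow> in_L2 M (Y k)"
    and V: "\<And>k. 1 \<le> k \<Longrightarrow> V k = (\<integral>\<omega>. (dist (Y k \<omega>) (m k))\<^sup>2 \<partial>M)"
    and var: "\<And>k z. 1 \<le> k \<Longrightarrow> V k + (dist z (m k))\<^sup>2 \<le> (\<integral>\<omega>. (dist (Y k \<omega>) z)\<^sup>2 \<partial>M)"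
    and D: "\<And>k. 1 \<le> k \<Longrightarrow> k \<le> n \<Longrightarrow> dist \<mu> (m k) \<le> D"
      "\<And>k. 1 \<le> k \<Longrightarrow> k \<le> n \<Longrightarrow> (\<integral>\<omega>. dist (Y k \<omega>) (m k) \<partial>M) \<le> D"
  shows "(real n)\<^sup>2 * (\<integral>\<omega>. (dist (inductive_mean (\<lambda>k. Y k \<omega>) n) \<mu>)\<^sup>2 \<partial>M)
    \<le> (\<Sum>k=1..n. V k) + 7 * real n * D * (\<Sum>k=1..n. dist (m k) \<mu>)"
proof -
  define S where "S j \<omega> = inductive_mean (\<lambda>k. Y k \<omega>) j" for j \<omega>
  define \<delta> where "\<delta> k = dist (m k) \<mu>" for k
  define A where "A j = (\<integral>\<omega>. (dist (S j \<omega>) \<mu>)\<^sup>2 \<partial>M)" for j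
  have D0: "0 \<le> D" using D(1)[of 1] n zero_le_dist[of \<mu> "m 1"] by linarith
  have \<delta>D: "0 \<le> \<delta> k" "1 \<le> k \<Longrightarrow> k \<le> n \<Longrightarrow> \<delta> k \<le> D" for k
    using D(1)[of k] by (auto simp: \<delta>_def dist_commute)
  have S1: "S (Suc 0) = Y 1" by (simp add: S_def fun_eq_iff)
  have L2S: "in_L2 M (S j)" if "j \<ge> 1" for j
    unfolding S_def using in_L2_inductive_mean[OF closed that sep L2] .
  note intY [simp] = in_L2_integrable[OF L2]
  note intS [simp] = in_L2_integrable[OF L2S]
  have step: "S (Suc j) \<omega> = geodesic_point (1 / real (Suc j)) (S j \<omega>) (Y (Suc j) \<omega>)" if "j \<ge> 1" for j \<omega>
    unfolding S_def by (rule inductive_mean_step[OF that])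

  have EY: "(\<integral>\<omega>. dist (Y k \<omega>) \<mu> \<partial>M) \<le> 2 * D" if k: "1 \<le> k" "k \<le> n" for k
  proof -
    have "(\<integral>\<omega>. dist (Y k \<omega>) \<mu> \<partial>M) \<le> (\<integral>\<omega>. dist (Y k \<omega>) (m k) + \<delta> k \<partial>M)"
      using k by (intro integral_mono) (auto simp: \<delta>_def dist_triangle)
    also have "\<dots> = (\<integral>\<omega>. dist (Y k \<omega>) (m k) \<partial>M) + \<delta> k" using k by (simp add: prob_space)
    finally show ?thesis using D(2)[OF k] \<delta>D(2)[OF k] by simp
  qed
  have ES: "(\<integral>\<omega>. dist (S j \<omega>) \<mu> \<partial>M) \<le> 2 * D" if "1 \<le> j" "j \<le> n" for j
    using that
  proof (induction j rule: nat_induct_at_least)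
    case base
    then show ?case using EY[of 1] S1 by simp
  next
    case (Suc j)
    define t where "t = 1 / real (Suc j)"
    have t: "0 \<le> t" "t \<le> 1" by (simp_all add: t_def)
    have "(\<integral>\<omega>. dist (S (Suc j) \<omega>) \<mu> \<partial>M)
        \<le> (\<integral>\<omega>. (1 - t) * dist (S j \<omega>) \<mu> + t * dist (Y (Suc j) \<omega>) \<mu> \<partial>M)"
    proof (rule integral_mono)
      show "dist (S (Suc j) \<omega>) \<mu> \<le> (1 - t) * dist (S j \<omega>) \<mu> + t * dist (Y (Suc j) \<omega>) \<mu>" for \<omega>
        using geodesic_point_dist_le[OF t, of \<mu> "S j \<omega>" "Y (Suc j) \<omega>"]
        unfolding step[OF Suc.hyps] t_def[symmetric] by (simp only: dist_commute)
    qed (use Suc.hyps in simp_all)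
    also have "\<dots> = (1 - t) * (\<integral>\<omega>. dist (S j \<omega>) \<mu> \<partial>M) + t * (\<integral>\<omega>. dist (Y (Suc j) \<omega>) \<mu> \<partial>M)"
      using Suc.hyps by simp
    also have "\<dots> \<le> (1 - t) * (2 * D) + t * (2 * D)"
      using t Suc EY[of "Suc j"] by (intro add_mono mult_left_mono) auto
    finally show ?case by (simp add: algebra_simps)
  qed

  have EY2: "(\<integral>\<omega>. (dist (Y k \<omega>) \<mu>)\<^sup>2 \<partial>M) \<le> V k + 3 * D * \<delta> k" if k: "1 \<le> k" "k \<le> n" for k
  proof -
    have "(\<integral>\<omega>. (dist (Y k \<omega>) \<mu>)\<^sup>2 \<partial>M)
        \<le> (\<integral>\<omega>. (dist (Y k \<omega>) (m k))\<^sup>2 + 2 * \<delta> k * dist (Y k \<omega>) (m k) + (\<delta> k)\<^sup>2 \<partial>M)"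
    proof (rule integral_mono)
      fix \<omega>
      have "(dist (Y k \<omega>) \<mu>)\<^sup>2 \<le> (dist (Y k \<omega>) (m k) + \<delta> k)\<^sup>2"
        unfolding \<delta>_def by (intro power_mono dist_triangle) simp
      thus "(dist (Y k \<omega>) \<mu>)\<^sup>2
          \<le> (dist (Y k \<omega>) (m k))\<^sup>2 + 2 * \<delta> k * dist (Y k \<omega>) (m k) + (\<delta> k)\<^sup>2"
        by (simp add: power2_sum ac_simps)
    qed (use k in simp_all)
    also have "\<dots> = V k + 2 * \<delta> k * (\<integral>\<omega>. dist (Y k \<omega>) (m k) \<partial>M) + (\<delta> k)\<^sup>2"
      using k by (simp add: V prob_space)
    also have "\<dots> \<le> V k + 2 * \<delta> k * D + D * \<delta> k"
      unfolding power2_eq_square using \<delta>D(1)[of k] \<delta>D(2)[OF k] D(2)[OF k]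
      by (intro add_mono mult_left_mono mult_right_mono order_refl) auto
    finally show ?thesis by (simp add: algebra_simps)
  qed

  have ESY: "A j - 4 * D * \<delta> (Suc j) + V (Suc j) \<le> (\<integral>\<omega>. (dist (S j \<omega>) (Y (Suc j) \<omega>))\<^sup>2 \<partial>M)"
    and intSY: "integrable M (\<lambda>\<omega>. (dist (S j \<omega>) (Y (Suc j) \<omega>))\<^sup>2)" if j: "1 \<le> j" "j < n" for j
  proof -
    note SY = mean_square_dist_indep_ge[where a=a and S="S j" and Y="Y (Suc j)" and V="V (Suc j)" and m="m (Suc j)"]
    have S_indep: "indep_var borel (S j) borel (Y (Suc j))"
      unfolding S_def by (rule indep_var_inductive_mean_next[OF closed j(1) indep sep])
    have S_mem: "S j \<omega> \<in> closure (range a)" for \<omega>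
      unfolding S_def using sep by (intro inductive_mean_mem[OF closed j(1)])
    show "integrable M (\<lambda>\<omega>. (dist (S j \<omega>) (Y (Suc j) \<omega>))\<^sup>2)"
      by (rule SY(1)) (use S_indep S_mem sep L2 L2S var j in auto)
    \<comment> \<open>Moving the reference point by \<open>\<delta> (Suc j)\<close> costs a term linear in \<open>d(S j, \<mu>)\<close>, whose mean is
      at most \<open>2 D\<close>.\<close>
    have "A j - 2 * \<delta> (Suc j) * (2 * D) \<le> A j - 2 * \<delta> (Suc j) * (\<integral>\<omega>. dist (S j \<omega>) \<mu> \<partial>M)"
      using \<delta>D(1) ES[of j] j by (intro diff_left_mono mult_left_mono) auto
    also have "\<dots> = (\<integral>\<omega>. (dist (S j \<omega>) \<mu>)\<^sup>2 - 2 * \<delta> (Suc j) * dist (S j \<omega>) \<mu> \<partial>M)"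
      using j by (simp add: A_def)
    also have "\<dots> \<le> (\<integral>\<omega>. (dist (S j \<omega>) (m (Suc j)))\<^sup>2 \<partial>M)"
    proof (rule integral_mono)
      fix \<omega>
      have "\<bar>dist (S j \<omega>) \<mu> - \<delta> (Suc j)\<bar> \<le> dist (S j \<omega>) (m (Suc j))"
        unfolding \<delta>_def by (metis abs_dist_diff_le dist_commute)
      hence "\<bar>dist (S j \<omega>) \<mu> - \<delta> (Suc j)\<bar>\<^sup>2 \<le> (dist (S j \<omega>) (m (Suc j)))\<^sup>2"
        by (intro power_mono) auto
      hence "(dist (S j \<omega>) \<mu>)\<^sup>2 + (\<delta> (Suc j))\<^sup>2 - 2 * \<delta> (Suc j) * dist (S j \<omega>) \<mu>
          \<le> (dist (S j \<omega>) (m (Suc j)))\<^sup>2"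
        by (simp add: power2_diff ac_simps)
      thus "(dist (S j \<omega>) \<mu>)\<^sup>2 - 2 * \<delta> (Suc j) * dist (S j \<omega>) \<mu>
          \<le> (dist (S j \<omega>) (m (Suc j)))\<^sup>2"
        using zero_le_power2[of "\<delta> (Suc j)"] by linarith
    qed (use j in simp_all)
    also have "V (Suc j) + \<dots> \<le> (\<integral>\<omega>. (dist (S j \<omega>) (Y (Suc j) \<omega>))\<^sup>2 \<partial>M)"
      by (rule SY(2)) (use S_indep S_mem sep L2 L2S var j in auto)
    finally show "A j - 4 * D * \<delta> (Suc j) + V (Suc j) \<le> (\<integral>\<omega>. (dist (S j \<omega>) (Y (Suc j) \<omega>))\<^sup>2 \<partial>M)"
      by (simp add: algebra_simps)
  qed

  have "(real j)\<^sup>2 * A j \<le> (\<Sum>k=1..j. V k) + 7 * real n * D * (\<Sum>k=1..j. \<delta> k)"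
    if "1 \<le> j" "j \<le> n" for j
    using that
  proof (induction j rule: nat_induct_at_least)
    case base
    have "A 1 \<le> V 1 + 3 * D * \<delta> 1" using EY2[of 1] n S1 by (simp add: A_def)
    also have "\<dots> \<le> V 1 + 7 * real n * D * \<delta> 1"
      using n D0 \<delta>D(1)[of 1] by (intro add_left_mono mult_right_mono) auto
    finally show ?case by simp
  next
    case (Suc j)
    define t where "t = 1 / real (Suc j)"
    have t: "0 \<le> t" "t \<le> 1" by (simp_all add: t_def)
    have jn: "j < n" using Suc by simp
    let ?B = "\<integral>\<omega>. (dist (S j \<omega>) (Y (Suc j) \<omega>))\<^sup>2 \<partial>M"
    have "A (Suc j) \<le> (\<integral>\<omega>. (1 - t) * (dist (S j \<omega>) \<mu>)\<^sup>2 + t * (dist (Y (Suc j) \<omega>) \<mu>)\<^sup>2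
        - t * (1 - t) * (dist (S j \<omega>) (Y (Suc j) \<omega>))\<^sup>2 \<partial>M)"
      unfolding A_def
    proof (rule integral_mono)
      show "(dist (S (Suc j) \<omega>) \<mu>)\<^sup>2 \<le> (1 - t) * (dist (S j \<omega>) \<mu>)\<^sup>2 + t * (dist (Y (Suc j) \<omega>) \<mu>)\<^sup>2
        - t * (1 - t) * (dist (S j \<omega>) (Y (Suc j) \<omega>))\<^sup>2" for \<omega>
        using geodesic_point_CN[OF t, of \<mu> "S j \<omega>" "Y (Suc j) \<omega>"]
        unfolding step[OF Suc.hyps] t_def[symmetric] by (simp only: dist_commute)
    qed (use Suc.hyps intSY[OF Suc.hyps jn] in simp_all)
    also have "\<dots> = (1 - t) * A j + t * (\<integral>\<omega>. (dist (Y (Suc j) \<omega>) \<mu>)\<^sup>2 \<partial>M) - t * (1 - t) * ?B"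
      using Suc.hyps intSY[OF Suc.hyps jn] by (simp add: A_def)
    also have "\<dots> \<le> (1 - t) * A j + t * (V (Suc j) + 3 * D * \<delta> (Suc j))
        - t * (1 - t) * (A j - 4 * D * \<delta> (Suc j) + V (Suc j))"
      using t EY2[of "Suc j"] ESY[OF Suc.hyps jn] jn
      by (intro diff_mono add_mono mult_left_mono order_refl) auto
    also have "\<dots> = (1 - t)\<^sup>2 * A j + t\<^sup>2 * V (Suc j) + t * (7 * D * \<delta> (Suc j)) - 4 * t\<^sup>2 * D * \<delta> (Suc j)"
      by (simp add: power2_eq_square algebra_simps)
    also have "\<dots> \<le> (1 - t)\<^sup>2 * A j + t\<^sup>2 * V (Suc j) + t * (7 * D * \<delta> (Suc j))"
      using D0 \<delta>D(1)[of "Suc j"] by simp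
    finally have le: "(real (Suc j))\<^sup>2 * A (Suc j) \<le>
        (real (Suc j))\<^sup>2 * ((1 - t)\<^sup>2 * A j + t\<^sup>2 * V (Suc j) + t * (7 * D * \<delta> (Suc j)))"
      by (rule mult_left_mono) simp
    have jt: "real (Suc j) * (1 - t) = real j" "real (Suc j) * t = 1"
      by (simp_all add: t_def field_simps)
    note le
    also have "(real (Suc j))\<^sup>2 * ((1 - t)\<^sup>2 * A j + t\<^sup>2 * V (Suc j) + t * (7 * D * \<delta> (Suc j)))
        = (real (Suc j) * (1 - t))\<^sup>2 * A j + (real (Suc j) * t)\<^sup>2 * V (Suc j)
        + real (Suc j) * (real (Suc j) * t) * (7 * D * \<delta> (Suc j))"
      by (simp only: power2_eq_square algebra_simps)
    also have "\<dots> = (real j)\<^sup>2 * A j + 1\<^sup>2 * V (Suc j) + real (Suc j) * 1 * (7 * D * \<delta> (Suc j))"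
      unfolding jt ..
    also have "(real j)\<^sup>2 * A j + 1\<^sup>2 * V (Suc j) + real (Suc j) * 1 * (7 * D * \<delta> (Suc j))
        \<le> ((\<Sum>k=1..j. V k) + 7 * real n * D * (\<Sum>k=1..j. \<delta> k)) + V (Suc j)
          + real n * (7 * D * \<delta> (Suc j))"
      using Suc.IH jn D0 \<delta>D(1)[of "Suc j"]
      by (intro add_mono mult_right_mono) auto
    finally show ?case by (simp add: algebra_simps)
  qed
  from this[of n] n show ?thesis unfolding A_def S_def \<delta>_def by simp
qed

section \<open>Passage to the completion\<close>

lemma measurable_completion_AE_eq:
  assumes g: "g \<in> measurable M N" and f: "f \<in> space M \<rightarrow> space N" and ae: "AE x in M. f x = g x"
  shows "f \<in> measurable (completion M) N"
proof (rule measurableI)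
  show "f x \<in> space N" if "x \<in> space (completion M)" for x
    using f that by auto
  fix B assume B: "B \<in> sets N"
  have "AE x in completion M. x \<in> g -` B \<inter> space M \<longleftrightarrow> x \<in> f -` B \<inter> space M"
    using AE_completion[OF ae] by eventually_elim auto
  moreover have "g -` B \<inter> space M \<in> sets (completion M)"
    using measurable_sets[OF g B] by auto
  ultimately have "f -` B \<inter> space M \<in> sets (completion M)"
    by (rule completion.in_sets_AE) auto
  thus "f -` B \<inter> space (completion M) \<in> sets (completion M)" by simp
qed

lemma (in prob_space) tendsto_in_L2_imp_probability:
  assumes "tendsto_in_L2 M Z (\<lambda>_. z)"
  shows "tendsto_in_probability M Z (\<lambda>_. z)"
proof -
  have [measurable]: "Z n \<in> borel_measurable M" for n
    using assms by (auto simp: tendsto_in_L2_def in_L2_def)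
  have int: "integrable M (\<lambda>\<omega>. (dist (Z n \<omega>) z)\<^sup>2)" for n
    using assms by (auto simp: tendsto_in_L2_def)
  have lim: "(\<lambda>n. \<integral>\<omega>. (dist (Z n \<omega>) z)\<^sup>2 \<partial>M) \<longlonglongrightarrow> 0"
    using assms by (auto simp: tendsto_in_L2_def)
  have "(\<lambda>n. measure M {\<omega> \<in> space M. dist (Z n \<omega>) z > \<epsilon>}) \<longlonglongrightarrow> 0" if \<epsilon>: "\<epsilon> > 0" for \<epsilon>
  proof (rule tendsto_sandwich[of "\<lambda>_. 0"])
    have "measure M {\<omega> \<in> space M. dist (Z n \<omega>) z > \<epsilon>}
        \<le> (\<integral>\<omega>. (dist (Z n \<omega>) z)\<^sup>2 \<partial>M) / \<epsilon>\<^sup>2" for n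
    proof -
      have "measure M {\<omega> \<in> space M. dist (Z n \<omega>) z > \<epsilon>}
          \<le> measure M {\<omega> \<in> space M. (dist (Z n \<omega>) z)\<^sup>2 \<ge> \<epsilon>\<^sup>2}"
        using \<epsilon> by (intro finite_measure_mono) (auto intro!: power_mono)
      also have "\<dots> \<le> (\<integral>\<omega>. (dist (Z n \<omega>) z)\<^sup>2 \<partial>M) / \<epsilon>\<^sup>2"
        using \<epsilon> by (intro integral_Markov_inequality_measure[where A="{}"] int) auto
      finally show ?thesis .
    qed
    thus "\<forall>\<^sub>F n in sequentially. measure M {\<omega> \<in> space M. dist (Z n \<omega>) z > \<epsilon>}
        \<le> (\<integral>\<omega>. (dist (Z n \<omega>) z)\<^sup>2 \<partial>M) / \<epsilon>\<^sup>2" by simp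
    show "(\<lambda>n. (\<integral>\<omega>. (dist (Z n \<omega>) z)\<^sup>2 \<partial>M) / \<epsilon>\<^sup>2) \<longlonglongrightarrow> 0"
      using tendsto_divide[OF lim tendsto_const, of "\<epsilon>\<^sup>2"] \<epsilon> by simp
  qed auto
  moreover have "(\<lambda>\<omega>. dist (Z n \<omega>) z) \<in> borel_measurable M" for n
    by measurable
  ultimately show ?thesis by (simp add: tendsto_in_probability_def)
qed

lemma in_L2_completion_AE_eq:
  assumes Y: "in_L2 M Y" and ae: "AE \<omega> in M. Z \<omega> = Y \<omega>"
  shows "in_L2 (completion M) Z"
proof -
  obtain x where Ym [measurable]: "Y \<in> borel_measurable M" and int: "integrable M (\<lambda>\<omega>. (dist (Y \<omega>) x)\<^sup>2)"
    using Y by (auto simp: in_L2_def)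
  have Zm [measurable]: "Z \<in> borel_measurable (completion M)"
    by (rule measurable_completion_AE_eq[OF Ym _ ae]) simp
  have "integrable (completion M) (\<lambda>\<omega>. (dist (Y \<omega>) x)\<^sup>2)"
    using int by (subst integrable_completion) auto
  hence "integrable (completion M) (\<lambda>\<omega>. (dist (Z \<omega>) x)\<^sup>2)"
    by (rule integrable_cong_AE_imp) (use AE_completion[OF ae] in auto)
  thus ?thesis using Zm by (auto simp: in_L2_def)
qed

lemma tendsto_in_L2_completion_AE_eq:
  assumes Y: "tendsto_in_L2 M Y (\<lambda>_. z)" and ae: "\<And>n. AE \<omega> in M. Z n \<omega> = Y n \<omega>"
  shows "tendsto_in_L2 (completion M) Z (\<lambda>_. z)"
proof -
  have L2: "in_L2 M (Y n)" "in_L2 M (\<lambda>_. z)"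
    and int: "integrable M (\<lambda>\<omega>. (dist (Y n \<omega>) z)\<^sup>2)" for n
    using Y by (simp_all add: tendsto_in_L2_def)
  have lim: "(\<lambda>n. \<integral>\<omega>. (dist (Y n \<omega>) z)\<^sup>2 \<partial>M) \<longlonglongrightarrow> 0"
    using Y by (simp add: tendsto_in_L2_def)
  have L2': "in_L2 (completion M) (Z n)" "in_L2 (completion M) (\<lambda>_. z)" for n
    using in_L2_completion_AE_eq[OF L2(1) ae] in_L2_completion_AE_eq[OF L2(2)] by auto
  have Zm [measurable]: "Z n \<in> borel_measurable (completion M)" for n
    using L2'(1) by (simp add: in_L2_def)
  have dY: "(\<lambda>\<omega>. (dist (Y n \<omega>) z)\<^sup>2) \<in> borel_measurable M" for n
    using int by (rule borel_measurable_integrable)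
  have eq: "AE \<omega> in completion M. (dist (Y n \<omega>) z)\<^sup>2 = (dist (Z n \<omega>) z)\<^sup>2" for n
    using AE_completion[OF ae[of n]] by eventually_elim simp
  have int': "integrable (completion M) (\<lambda>\<omega>. (dist (Y n \<omega>) z)\<^sup>2)" for n
    using int dY by (subst integrable_completion) auto
  have intZ: "integrable (completion M) (\<lambda>\<omega>. (dist (Z n \<omega>) z)\<^sup>2)" for n
    by (rule integrable_cong_AE_imp[OF int' _ eq]) measurable
  have "(\<integral>\<omega>. (dist (Z n \<omega>) z)\<^sup>2 \<partial>completion M) = (\<integral>\<omega>. (dist (Y n \<omega>) z)\<^sup>2 \<partial>M)" for n
  proof -
    have "(\<integral>\<omega>. (dist (Y n \<omega>) z)\<^sup>2 \<partial>completion M) = (\<integral>\<omega>. (dist (Z n \<omega>) z)\<^sup>2 \<partial>completion M)"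
      using int' intZ eq by (intro integral_cong_AE) auto
    thus ?thesis using integral_completion[OF dY] by simp
  qed
  thus ?thesis using L2' intZ lim by (simp add: tendsto_in_L2_def)
qed

section \<open>The law of large numbers\<close>

theorem corollary1:
  fixes M :: "'w measure"
    and X :: "nat \<Rightarrow> 'w \<Rightarrow> 'a::hadamard_space"
    and \<mu>s :: "nat \<Rightarrow> 'a" and \<mu> :: 'a
    and D :: "nat \<Rightarrow> real"
  assumes "prob_space M"
    and indep: "prob_space.indep_vars M (\<lambda>_. borel) X {1..}"
    and L2: "\<And>n. n \<ge> 1 \<Longrightarrow> in_L2 M (X n)"
    and sep: "\<And>n. n \<ge> 1 \<Longrightarrow> essentially_separable M (X n)"
    and means: "\<And>n. n \<ge> 1 \<Longrightarrow> hadamard_expectation M (X n) = \<mu>s n"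
    and D_eq: "\<And>n. n \<ge> 1 \<Longrightarrow>
      D n = Max ((\<lambda>k. max (dist \<mu> (\<mu>s k)) (\<integral>\<omega>. dist (X k \<omega>) (\<mu>s k) \<partial>M)) ` {1..n})"
    and cond1: "(\<lambda>n. D n * (1 / real n * (\<Sum>k=1..n. dist (\<mu>s k) \<mu>))) \<longlonglongrightarrow> 0"
    and cond2: "(\<lambda>n. 1 / (real n)\<^sup>2 * (\<Sum>k=1..n. hadamard_variance M (X k))) \<longlonglongrightarrow> 0"
  shows "tendsto_in_L2 (completion M) (\<lambda>n \<omega>. inductive_mean (\<lambda>k. X k \<omega>) n) (\<lambda>_. \<mu>) \<and>
    tendsto_in_probability (completion M) (\<lambda>n \<omega>. inductive_mean (\<lambda>k. X k \<omega>) n) (\<lambda>_. \<mu>)"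
proof -
  interpret prob_space M by fact
  have "\<exists>A. countable A \<and> (AE \<omega> in M. X k \<omega> \<in> closure A)" if "k \<ge> 1" for k
    using sep[OF that] by (simp add: essentially_separable_def)
  then obtain A where A: "\<And>k. k \<ge> 1 \<Longrightarrow> countable (A k)"
    "\<And>k. k \<ge> 1 \<Longrightarrow> AE \<omega> in M. X k \<omega> \<in> closure (A k)" by metis
  \<comment> \<open>One separable set for all variables. The point \<open>\<mu>\<close> serves as the value on the null sets.\<close>
  have "countable (insert \<mu> (\<Union>k\<in>{1..}. A k))" using A(1) by auto
  then obtain B where B: "countable B" "insert \<mu> (\<Union>k\<in>{1..}. A k) \<subseteq> B" "mean_closed B"
    by (rule countable_mean_closed_hull)
  define a where "a = from_nat_into B"
  have ra: "range a = B" unfolding a_def using B by (intro range_from_nat_into) auto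
  define C where "C = closure (range a)"
  have closed: "mean_closed C" unfolding C_def ra by (rule mean_closed_closure[OF B(3)])
  have XC: "AE \<omega> in M. X k \<omega> \<in> C" if "k \<ge> 1" for k
    using A(2)[OF that]
  proof eventually_elim
    case (elim \<omega>)
    have "closure (A k) \<subseteq> C" unfolding C_def ra using B(2) that by (intro closure_mono) auto
    thus ?case using elim by blast
  qed
  define r where "r x = (if x \<in> C then x else \<mu>)" for x
  have r [measurable]: "r \<in> borel_measurable borel" unfolding r_def C_def by measurable
  have rC: "r x \<in> C" for x
    using B(2) closure_subset[of B] by (auto simp: r_def C_def ra)
  define Y where "Y k \<omega> = r (X k \<omega>)" for k \<omega>
  have ae: "AE \<omega> in M. X k \<omega> = Y k \<omega>" if "k \<ge> 1" for k
    using XC[OF that] by eventually_elim (simp add: Y_def r_def)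
  have Xm [measurable]: "X k \<in> borel_measurable M" if "k \<ge> 1" for k
    using L2[OF that] by (simp add: in_L2_def)
  have Ym: "Y k \<in> borel_measurable M" if "k \<ge> 1" for k
    unfolding Y_def by (rule measurable_compose[OF Xm[OF that] r])
  have int_eq: "(\<integral>\<omega>. h (Y k \<omega>) \<partial>M) = (\<integral>\<omega>. h (X k \<omega>) \<partial>M)"
    if "k \<ge> 1" and h [measurable]: "h \<in> borel_measurable borel" for k and h :: "'a \<Rightarrow> real"
    using ae[OF that(1)] measurable_compose[OF Xm[OF that(1)] h] measurable_compose[OF Ym[OF that(1)] h]
    by (intro integral_cong_AE) auto
  have L2Y: "in_L2 M (Y k)" if "k \<ge> 1" for k
  proof -
    have int: "integrable M (\<lambda>\<omega>. (dist (X k \<omega>) \<mu>)\<^sup>2)"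
      by (rule in_L2_integrable(1)[OF L2[OF that]])
    have [measurable]: "X k \<in> borel_measurable M" "Y k \<in> borel_measurable M"
      using Xm Ym that by auto
    have "integrable M (\<lambda>\<omega>. (dist (Y k \<omega>) \<mu>)\<^sup>2)"
      by (rule integrable_cong_AE_imp[OF int]) (use ae[OF that] in auto)
    thus ?thesis using Ym[OF that] by (auto simp: in_L2_def)
  qed
  have indepY: "indep_vars (\<lambda>_. borel) Y {1..}"
    unfolding Y_def by (rule indep_vars_compose2[OF indep]) simp
  define S where "S n \<omega> = inductive_mean (\<lambda>k. Y k \<omega>) n" for n \<omega>
  have YC: "Y k \<omega> \<in> closure (range a)" for k \<omega>
    using rC by (simp add: Y_def C_def)
  note closed = closed[unfolded C_def]
  have L2S: "in_L2 M (S n)" if "n \<ge> 1" for n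
    unfolding S_def by (rule in_L2_inductive_mean[OF closed that YC L2Y])
  define V where "V k = hadamard_variance M (X k)" for k
  have dsq: "(\<lambda>x. (dist x z)\<^sup>2) \<in> borel_measurable borel" and dm: "(\<lambda>x. dist x z) \<in> borel_measurable borel"
    for z :: 'a by measurable
  have bound: "(real n)\<^sup>2 * (\<integral>\<omega>. (dist (S n \<omega>) \<mu>)\<^sup>2 \<partial>M)
      \<le> (\<Sum>k=1..n. V k) + 7 * real n * D n * (\<Sum>k=1..n. dist (\<mu>s k) \<mu>)" if n: "n \<ge> 1" for n
    unfolding S_def
  proof (rule mean_square_inductive_mean_le[OF closed n indepY YC L2Y])
    show "V k = (\<integral>\<omega>. (dist (Y k \<omega>) (\<mu>s k))\<^sup>2 \<partial>M)" if "1 \<le> k" for k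
      using int_eq[OF that dsq] means[OF that] by (simp add: V_def hadamard_variance_def)
    show "V k + (dist z (\<mu>s k))\<^sup>2 \<le> (\<integral>\<omega>. (dist (Y k \<omega>) z)\<^sup>2 \<partial>M)" if "1 \<le> k" for k z
      using int_eq[OF that dsq] means[OF that] hadamard_variance_inequality[OF L2[OF that], of z]
      by (simp add: V_def hadamard_variance_def)
    fix k assume k: "1 \<le> k" "k \<le> n"
    have "max (dist \<mu> (\<mu>s k)) (\<integral>\<omega>. dist (X k \<omega>) (\<mu>s k) \<partial>M) \<le> D n"
      unfolding D_eq[OF n] using k by (intro Max_ge) auto
    thus "dist \<mu> (\<mu>s k) \<le> D n" "(\<integral>\<omega>. dist (Y k \<omega>) (\<mu>s k) \<partial>M) \<le> D n"
      using int_eq[OF k(1) dm] by auto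
  qed
  have lim: "(\<lambda>n. \<integral>\<omega>. (dist (S n \<omega>) \<mu>)\<^sup>2 \<partial>M) \<longlonglongrightarrow> 0"
  proof (rule tendsto_sandwich[of "\<lambda>_. 0"])
    show "\<forall>\<^sub>F n in sequentially. (\<integral>\<omega>. (dist (S n \<omega>) \<mu>)\<^sup>2 \<partial>M)
        \<le> 1 / (real n)\<^sup>2 * (\<Sum>k=1..n. V k) + 7 * (D n * (1 / real n * (\<Sum>k=1..n. dist (\<mu>s k) \<mu>)))"
      using eventually_ge_at_top[of 1]
    proof eventually_elim
      case (elim n)
      thus ?case using bound[OF elim] by (simp add: field_simps power2_eq_square)
    qed
    show "(\<lambda>n. 1 / (real n)\<^sup>2 * (\<Sum>k=1..n. V k)
        + 7 * (D n * (1 / real n * (\<Sum>k=1..n. dist (\<mu>s k) \<mu>)))) \<longlonglongrightarrow> 0"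
      using tendsto_add[OF cond2 tendsto_mult[OF tendsto_const[of 7] cond1]] by (simp add: V_def)
  qed auto
  \<comment> \<open>The dummy value at index 0 repeats the first variable.\<close>
  have S0: "S 0 = S 1" by (simp add: S_def fun_eq_iff)
  have "in_L2 M (S n)" for n using L2S S0 by (cases "n = 0") auto
  moreover have "in_L2 M (\<lambda>_. \<mu>)" by (simp add: in_L2_def)
  ultimately have "tendsto_in_L2 M S (\<lambda>_. \<mu>)"
    using lim by (simp add: tendsto_in_L2_def in_L2_integrable)
  moreover have "AE \<omega> in M. inductive_mean (\<lambda>k. X k \<omega>) n = S n \<omega>" for n
  proof -
    have "AE \<omega> in M. \<forall>k\<in>{1..}. X k \<omega> = Y k \<omega>"
      using ae by (subst AE_ball_countable) auto
    thus ?thesis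
    proof eventually_elim
      case (elim \<omega>)
      show ?case
      proof (cases "n = 0")
        case True
        thus ?thesis using elim by (simp add: S_def)
      next
        case False
        thus ?thesis unfolding S_def using elim by (intro inductive_mean_cong) auto
      qed
    qed
  qed
  ultimately have L2conv:
    "tendsto_in_L2 (completion M) (\<lambda>n \<omega>. inductive_mean (\<lambda>k. X k \<omega>) n) (\<lambda>_. \<mu>)"
    by (rule tendsto_in_L2_completion_AE_eq)
  thus ?thesis
    using prob_space.tendsto_in_L2_imp_probability[OF prob_space_completion] by blast
qed

end
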